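(* Let $\alpha\ge3$, $q\ge2$ and $0\le\rho<\alpha$ be integers, and let $b$ be the balanced cyclic binary word of length $\alpha$ with exactly $\rho$ ones (unique up to rotation). Every cyclic binary word $w$ of length $\alpha$ with exactly $\rho$ ones satisfies $$I(C_q(w);x)\preceq_{\mathrm{cf}} I(C_q(b);x),$$ with equality if and only if $w$ is balanced. More precisely, if $w$ is not balanced and $r$ is its least imbalance length, then $$i_j(C_q(w))=i_j(C_q(b))\quad(0\le j<2r),\qquad i_j(C_q(w))<i_j(C_q(b))\quad(2r\le j\le\alpha).$$
   Context: All graphs are finite and simple. $i_j(G)$ is the number of independent sets of $G$ of cardinality $j$, and $I(G;x)=\sum_{j\ge 0} i_j(G)x^j$. For $f,g\in\mathbb Z[x]$, $f\preceq_{\mathrm{cf}} g$ means that every coefficient of $f$ is at most the corresponding coefficient of $g$. Graphs $C_q(w)$: let $\alpha\ge3$, $q\ge2$, and let $w=w_0\cdots w_{\alpha-1}$ be a binary word. Take disjoint cliques $C_i\cong K_{q+w_i}$ for $i\in\mathbb Z/\alpha\mathbb Z$, choose distinct vertices $x_i,y_i\in C_i$ for each $i$, and add the linking edges $y_ix_{i+1}$ for all $i\in\mathbb Z/\alpha\mathbb Z$ (indices modulo $\alpha$). The resulting graph is $C_q(w)$; up to isomorphism it does not depend on the choice of $x_i,y_i$, nor on rotating or reversing $w$. A cyclic binary word is a binary word considered up to rotation; its cyclic factors are the contiguous factors of its periodic extension. It is balanced if any two cyclic factors of the same length contain numbers of $1$'s differing by at most one. If it is not balanced, its least imbalance length is the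 least $r$ such that some two cyclic factors of length $r$ contain numbers of $1$'s differing by at least two. The balanced cyclic word $b$ is given by $b_i=\lfloor (i+1)\rho/\alpha\rfloor-\lfloor i\rho/\alpha\rfloor$ for $0\le i<\alpha$. *)

theory Defs
  imports "HOL-Computational_Algebra.Polynomial"
begin

section \<open>Graphs and independence polynomials\<close>

type_synonym 'a graph = "'a set \<times> 'a set set"

abbreviation verts :: "'a graph \<Rightarrow> 'a set" where "verts \<equiv> fst"
abbreviation edges :: "'a graph \<Rightarrow> 'a set set" where "edges \<equiv> snd"

definition simple_graph :: "'a graph \<Rightarrow> bool" where
  "simple_graph G \<longleftrightarrow> finite (verts G) \<and> (\<forall>e\<in>edges G. e \<subseteq> verts G \<and> card e = 2)"

definition independent :: "'a graph \<Rightarrow> 'a set \<Rightarrow> bool" where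
  "independent G S \<longleftrightarrow> S \<subseteq> verts G \<and> (\<forall>e\<in>edges G. \<not> e \<subseteq> S)"

definition indep_count :: "'a graph \<Rightarrow> nat \<Rightarrow> nat" where
  "indep_count G j = card {S. independent G S \<and> card S = j}"

definition indep_poly :: "'a graph \<Rightarrow> int poly" where
  "indep_poly G = (\<Sum>j\<le>card (verts G). monom (int (indep_count G j)) j)"

definition cf_le :: "int poly \<Rightarrow> int poly \<Rightarrow> bool"  (infix "\<preceq>\<^sub>c\<^sub>f" 50) where
  "f \<preceq>\<^sub>c\<^sub>f g \<longleftrightarrow> (\<forall>n. coeff f n \<le> coeff g n)"


section \<open>Cyclic binary words\<close>

text \<open>A cyclic word is represented by any of its linear representatives; being
  balanced and the least imbalance length are invariant under \<^const>\<open>rotate\<close>.\<close>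

definition binary_word :: "nat list \<Rightarrow> bool" where
  "binary_word w \<longleftrightarrow> set w \<subseteq> {0, 1}"

abbreviation ones :: "nat list \<Rightarrow> nat" where
  "ones u \<equiv> count_list u 1"

text \<open>The factor of length \<open>r\<close> starting at position \<open>i\<close> of the periodic extension of \<open>w\<close>;
  \<open>r\<close> may exceed the length of \<open>w\<close>.\<close>

definition cyclic_factor :: "nat list \<Rightarrow> nat \<Rightarrow> nat \<Rightarrow> nat list" where
  "cyclic_factor w i r = map (\<lambda>k. w ! ((i + k) mod length w)) [0..<r]"

definition balanced :: "nat list \<Rightarrow> bool" where
  "balanced w \<longleftrightarrow>
     (\<forall>r i j. \<bar>int (ones (cyclic_factor w i r)) - int (ones (cyclic_factor w j r))\<bar> \<le> 1)"

definition least_imbalance :: "nat list \<Rightarrow> nat" where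
  "least_imbalance w =
     (LEAST r. \<exists>i j. \<bar>int (ones (cyclic_factor w i r)) - int (ones (cyclic_factor w j r))\<bar> \<ge> 2)"

text \<open>Natural division is the floor of the quotient; the natural subtraction never
  truncates because \<open>i * \<rho> div \<alpha>\<close> is monotone in \<open>i\<close>.\<close>

definition balanced_word :: "nat \<Rightarrow> nat \<Rightarrow> nat list" where
  "balanced_word \<alpha> \<rho> = map (\<lambda>i. (i + 1) * \<rho> div \<alpha> - i * \<rho> div \<alpha>) [0..<\<alpha>]"


section \<open>The graphs \<open>C\<^sub>q(w)\<close>\<close>

text \<open>The clique \<open>C\<^sub>i\<close> has vertex set \<open>{i} \<times> {..<q + w\<^sub>i}\<close>, with \<open>x\<^sub>i = (i, 0)\<close> and
  \<open>y\<^sub>i = (i, 1)\<close>. Up to isomorphism the choice of two distinct vertices is immaterial.\<close>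

definition clique_verts :: "nat \<Rightarrow> nat list \<Rightarrow> nat \<Rightarrow> (nat \<times> nat) set" where
  "clique_verts q w i = {i} \<times> {..<q + w ! i}"

definition clique_cycle :: "nat \<Rightarrow> nat list \<Rightarrow> (nat \<times> nat) graph" where
  "clique_cycle q w =
     ((\<Union>i<length w. clique_verts q w i),
      (\<Union>i<length w. {{u, v} | u v. u \<in> clique_verts q w i \<and> v \<in> clique_verts q w i \<and> u \<noteq> v})
      \<union> {{(i, 1), ((i + 1) mod length w, 0)} | i. i < length w})"

lemma simple_graph_clique_cycle:
  assumes "q \<ge> 2"
  shows "simple_graph (clique_cycle q w)"
proof -
  have "(i + 1) mod length w < length w" if "i < length w" for i
    using that by (intro mod_less_divisor) auto
  with assms show ?thesis
    by (fastforce simp: simple_graph_def clique_cycle_def clique_verts_def)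
qed

end

theory Submission
  imports Defs
begin

text \<open>
  Choosing at most one vertex per clique and excluding the linking edges, which can only be violated
  along a matching, gives \<open>I(C\<^sub>q(w)) = K(w) - x\<^sup>2 K(w\<^sup>\<circ>)\<close>, where \<open>K\<close> is the continuant
  in the letters \<open>1 + (q + w\<^sub>i) x\<close> with parameter \<open>x\<^sup>2\<close> and \<open>w\<^sup>\<circ>\<close> is \<open>w\<close> without its two end letters.

  If \<open>w\<close> is unbalanced with least imbalance length \<open>r\<close>, a rotation of \<open>w\<close> has the form \<open>S Y\<close> with
  \<open>S = u 0 P 1 u\<close>, \<open>Y = 1 Q 0\<close> and a palindrome \<open>u\<close> of length \<open>r - 2\<close>. Reversing \<open>S\<close> changes the
  polynomial by \<open>- x\<^sup>2 D(S) D(Y)\<close>, where \<open>D\<close> is the difference of the continuants without the last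
  and without the first letter. Since \<open>D(a V b) = (a - b) K(V) + x\<^sup>2 D(V)\<close>, the palindrome only
  contributes a power of \<open>x\<close>, and the change equals
  \<open>x\<^bsup>2r\<^esup> (K(P) - x D(P)) (K(Q) + x D(Q))\<close>. The factors have positive coefficients up to degrees
  \<open>|P|\<close> and \<open>|Q|\<close>, with \<open>2r + |P| + |Q| = \<alpha>\<close>. The reversal keeps the counts in all windows
  shorter than \<open>r\<close>, so iterating it ends in a balanced word without touching the coefficients
  below \<open>2r\<close>.
\<close>

section \<open>Continuants\<close>

text \<open>The determinant of the tridiagonal matrix with the list on the diagonal and products
  \<open>t\<close> of opposite off-diagonal entries. Equivalently, a sum over matchings of the path
  of letters, where an edge replaces its two letters by \<open>-t\<close>.\<close>

fun continuant :: "'a::comm_ring_1 \<Rightarrow> 'a list \<Rightarrow> 'a" where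
  "continuant t [] = 1"
| "continuant t [a] = a"
| "continuant t (a # b # xs) = a * continuant t (b # xs) - t * continuant t xs"

lemma continuant_Cons:
  "xs \<noteq> [] \<Longrightarrow> continuant t (a # xs) = a * continuant t xs - t * continuant t (tl xs)"
  by (cases xs) auto

text \<open>A matching of the whole path either avoids the edge across the cut, or uses it and
  removes the last letter of \<open>xs\<close> and the first letter of \<open>ys\<close>.\<close>

lemma continuant_append:
  assumes "xs \<noteq> []" "ys \<noteq> []"
  shows "continuant t (xs @ ys)
    = continuant t xs * continuant t ys - t * continuant t (butlast xs) * continuant t (tl ys)"
  using assms
proof (induction t xs rule: continuant.induct)
  case (3 t a b xs)
  show ?case
  proof (cases xs)
    case Nil
    then show ?thesis
      using 3 by (simp add: continuant_Cons algebra_simps)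
  next
    case (Cons c zs)
    have "continuant t ((a # b # xs) @ ys)
        = a * continuant t ((b # xs) @ ys) - t * continuant t (xs @ ys)" by simp
    moreover have "continuant t (butlast (a # b # xs))
        = a * continuant t (butlast (b # xs)) - t * continuant t (butlast xs)"
      using Cons by (simp add: continuant_Cons)
    moreover have "continuant t ((b # xs) @ ys) = continuant t (b # xs) * continuant t ys
        - t * continuant t (butlast (b # xs)) * continuant t (tl ys)"
      using 3 by blast
    moreover have "continuant t (xs @ ys)
        = continuant t xs * continuant t ys - t * continuant t (butlast xs) * continuant t (tl ys)"
      using 3 Cons by blast
    ultimately show ?thesis
      by (simp only: continuant.simps) (simp only: algebra_simps)
  qed
qed (auto simp: continuant_Cons)

lemma continuant_snoc:
  "xs \<noteq> [] \<Longrightarrow> continuant t (xs @ [a]) = a * continuant t xs - t * continuant t (butlast xs)"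
  by (simp add: continuant_append mult.commute)

lemma continuant_rev [simp]: "continuant t (rev xs) = continuant t xs"
proof (induction t xs rule: continuant.induct)
  case (3 t a b xs)
  have "continuant t (rev (b # xs) @ [a])
      = a * continuant t (rev (b # xs)) - t * continuant t (butlast (rev (b # xs)))"
    by (rule continuant_snoc) simp
  with 3 show ?case by simp
qed auto

text \<open>The same matching sum over a cycle: the second term collects the matchings that use the
  edge joining the last letter to the first.\<close>

definition cyclic_continuant :: "'a::comm_ring_1 \<Rightarrow> 'a list \<Rightarrow> 'a" where
  "cyclic_continuant t xs = continuant t xs - t * continuant t (butlast (tl xs))"

text \<open>Expanding at the moved letter \<open>a\<close> yields \<open>a\<close> K(ys) -
  \<open>t\<close> K(tl ys) - \<open>t\<close> K(butlast ys) on both sides.\<close>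

lemma cyclic_continuant_rotate1:
  assumes "length xs \<ge> 2"
  shows "cyclic_continuant t (rotate1 xs) = cyclic_continuant t xs"
proof -
  obtain a ys where xs: "xs = a # ys" "ys \<noteq> []"
    using assms by (cases xs; cases "tl xs") auto
  then have "butlast (tl (ys @ [a])) = tl ys"
    by (cases ys) auto
  with xs show ?thesis
    by (simp add: cyclic_continuant_def continuant_Cons continuant_snoc)
qed

lemma cyclic_continuant_rotate:
  assumes "length xs \<ge> 2"
  shows "cyclic_continuant t (rotate k xs) = cyclic_continuant t xs"
  using assms by (induction k) (auto simp: cyclic_continuant_rotate1)

text \<open>Measures the asymmetry of a list: it changes sign under reversal and vanishes on
  palindromes and on the empty list.\<close>

definition end_diff :: "'a::comm_ring_1 \<Rightarrow> 'a list \<Rightarrow> 'a" where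
  "end_diff t xs = continuant t (butlast xs) - continuant t (tl xs)"

text \<open>Expanding both continuants at their outer letters leaves the common factor K(xs), and
  the two remainders combine to \<open>t\<close> D(xs).\<close>

lemma end_diff_Cons_snoc:
  "end_diff t (a # xs @ [b]) = (a - b) * continuant t xs + t * end_diff t xs"
  by (cases "xs = []")
    (auto simp: end_diff_def continuant_Cons continuant_snoc butlast_append algebra_simps)

lemma tl_rev: "tl (rev xs) = rev (butlast xs)"
  by (cases xs rule: rev_cases) auto

lemma end_diff_rev: "end_diff t (rev xs) = - end_diff t xs"
  by (simp add: end_diff_def tl_rev)

text \<open>Each surrounding pair of equal letters cancels the first term of
  \<open>end_diff_Cons_snoc\<close> and leaves one factor \<open>t\<close>.\<close>

lemma end_diff_surround:
  "end_diff t (us @ xs @ rev us) = t ^ length us * end_diff t xs"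
proof (induction us)
  case (Cons a us)
  have "end_diff t ((a # us) @ xs @ rev (a # us)) = end_diff t (a # (us @ xs @ rev us) @ [a])"
    by simp
  also have "\<dots> = t * end_diff t (us @ xs @ rev us)"
    by (subst end_diff_Cons_snoc) simp
  finally show ?case using Cons by (simp add: algebra_simps)
qed simp

text \<open>Two edges of the cycle join \<open>xs\<close> to \<open>ys\<close>. The terms using
  neither or both are invariant under reversing \<open>xs\<close>. In the terms using exactly one,
  reversal swaps \<open>butlast xs\<close> with \<open>tl xs\<close>, and the resulting change
  factors.\<close>

lemma cyclic_continuant_reverse_segment:
  assumes "length xs \<ge> 2" "length ys \<ge> 2"
  shows "cyclic_continuant t (rev xs @ ys)
    = cyclic_continuant t (xs @ ys) - t * end_diff t xs * end_diff t ys"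
proof -
  have expand: "cyclic_continuant t (zs @ ys)
      = continuant t zs * continuant t ys
        - t * (continuant t (butlast zs) * continuant t (tl ys)
               + continuant t (tl zs) * continuant t (butlast ys)
               - t * continuant t (butlast (tl zs)) * continuant t (tl (butlast ys)))"
    if "length zs \<ge> 2" for zs
  proof -
    have ne: "zs \<noteq> []" "ys \<noteq> []" "tl zs \<noteq> []" "butlast ys \<noteq> []"
      using that assms by (auto simp: tl_Nil butlast_conv_take)
    then have "butlast (tl (zs @ ys)) = tl zs @ butlast ys"
      by (simp add: butlast_append)
    with ne show ?thesis
      by (simp add: cyclic_continuant_def continuant_append algebra_simps)
  qed
  have "butlast (tl (rev xs)) = rev (butlast (tl xs))"
    by (simp add: tl_rev butlast_tl)
  with expand[of xs] expand[of "rev xs"] assms show ?thesis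
    by (simp add: end_diff_def tl_rev algebra_simps)
qed

section \<open>Positivity of coefficients\<close>

definition pos_upto :: "nat \<Rightarrow> int poly \<Rightarrow> bool" where
  "pos_upto n p \<longleftrightarrow> (\<forall>k. coeff p k \<ge> 0) \<and> (\<forall>k\<le>n. coeff p k > 0)"

lemma pos_upto_add:
  "pos_upto n p \<Longrightarrow> (\<And>k. coeff r k \<ge> 0) \<Longrightarrow> pos_upto n (p + r)"
  by (auto simp: pos_upto_def add_pos_nonneg)

lemma pos_upto_add_shift:
  assumes "\<And>k. coeff p k \<ge> 0" "coeff p 0 > 0" "pos_upto n r"
  shows "pos_upto (Suc n) (p + [:0, 1:] * r)"
  unfolding pos_upto_def
proof (intro conjI allI impI)
  fix k
  show "coeff (p + [:0, 1:] * r) k \<ge> 0"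
    using assms(1)[of k] assms(3) by (cases k) (auto simp: pos_upto_def)
  assume "k \<le> Suc n"
  then show "coeff (p + [:0, 1:] * r) k > 0"
    using assms(1)[of k] assms(2,3) by (cases k) (auto simp: pos_upto_def add_nonneg_pos)
qed

lemma pos_upto_mult:
  assumes "pos_upto m p" "pos_upto n r"
  shows "pos_upto (m + n) (p * r)"
  unfolding pos_upto_def
proof (intro conjI allI impI)
  fix k
  have nonneg: "coeff p i * coeff r (k - i) \<ge> 0" for i
    using assms by (simp add: pos_upto_def)
  show "coeff (p * r) k \<ge> 0"
    unfolding coeff_mult by (intro sum_nonneg nonneg)
  assume "k \<le> m + n"
  \<comment> \<open>Taking \<open>min k m\<close> from the first factor leaves an index of at most
    \<open>n\<close> for the second, so this term of the convolution is positive.\<close>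
  then have "coeff p (min k m) * coeff r (k - min k m) > 0"
    using assms by (intro mult_pos_pos) (auto simp: pos_upto_def)
  then show "coeff (p * r) k > 0"
    unfolding coeff_mult by (intro sum_pos2[of _ "min k m"] nonneg) auto
qed

text \<open>The independence polynomial of a clique on \<open>q + c\<close> vertices. The parameter
  x^2 used below is the weight of the two endpoints of a link.\<close>

definition letter_weight :: "nat \<Rightarrow> nat \<Rightarrow> int poly" where
  "letter_weight q c = [:1, int (q + c):]"

abbreviation path_poly :: "nat \<Rightarrow> nat list \<Rightarrow> int poly" where
  "path_poly q w \<equiv> continuant ([:0, 1:] ^ 2) (map (letter_weight q) w)"

abbreviation cycle_poly :: "nat \<Rightarrow> nat list \<Rightarrow> int poly" where
  "cycle_poly q w \<equiv> cyclic_continuant ([:0, 1:] ^ 2) (map (letter_weight q) w)"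

abbreviation path_diff :: "nat \<Rightarrow> nat list \<Rightarrow> int poly" where
  "path_diff q w \<equiv> end_diff ([:0, 1:] ^ 2) (map (letter_weight q) w)"

text \<open>The recursion has a negative term, so the induction carries the stronger bound that K(w)
  still dominates x K(tl w). For the empty word that difference would be 1 - x.\<close>

lemma pos_upto_path_poly_aux:
  assumes "q \<ge> 2" "w \<noteq> []"
  shows "pos_upto (length w) (path_poly q w)
    \<and> pos_upto (length w) (path_poly q w - [:0, 1:] * path_poly q (tl w))"
  using assms(2)
proof (induction w)
  case (Cons a w)
  let ?x = "[:0, 1:] :: int poly" and ?K = "path_poly q"
  have split: "?K (a # w) = (?K (a # w) - ?x * ?K w) + ?x * ?K w"
    by simp
  have shift: "coeff (?x * p) k = (if k = 0 then 0 else coeff p (k - 1))" for p k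
    by (simp add: coeff_pCons split: nat.split)
  have G: "pos_upto (length (a # w)) (?K (a # w) - ?x * ?K w)"
  proof (cases "w = []")
    case True
    then show ?thesis
      using assms(1)
      by (auto simp: pos_upto_def letter_weight_def coeff_pCons one_pCons split: nat.splits)
  next
    case False
    have "smult 2 p = 2 * p" for p :: "int poly"
      by (metis mult_2 one_add_one smult_1_left smult_add_left)
    \<comment> \<open>After the subtraction \<open>q + a - 1\<close> copies of x K(w) remain. One is
      paired with the negative term -x^2 K(tl w), and \<open>q \<ge> 2\<close> keeps the other
      multiple nonnegative.\<close>
    then have "?K (a # w) - ?x * ?K w
        = (?K w + smult (int (q + a - 2)) (?x * ?K w)) + ?x * (?K w - ?x * ?K (tl w))"
      using assms(1) False
      by (simp add: continuant_Cons letter_weight_def map_tl power2_eq_square algebra_simps of_nat_diff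
          smult_diff_left)
    moreover have "pos_upto (length w) (?K w)"
      "pos_upto (length w) (?K w - ?x * ?K (tl w))"
      using Cons.IH False by auto
    moreover have "coeff (?K w + smult (int (q + a - 2)) (?x * ?K w)) k \<ge> 0"
      "coeff (?K w + smult (int (q + a - 2)) (?x * ?K w)) 0 > 0" for k
      using calculation(2) unfolding coeff_add coeff_smult shift by (auto simp: pos_upto_def)
    ultimately show ?thesis
      using pos_upto_add_shift by (simp only: length_Cons)
  qed
  have K: "coeff (?K w) k \<ge> 0" for k
    using Cons.IH by (cases "w = []") (auto simp: pos_upto_def)
  have "coeff (?x * ?K w) k \<ge> 0" for k
    unfolding shift using K by simp
  then have "pos_upto (length (a # w)) (?K (a # w))"
    using pos_upto_add[OF G, of "?x * ?K w"] split by simp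
  with G show ?case by simp
qed simp

text \<open>Regrouping gives (K(w) - x K(tl w)) + x K(butlast w), a strictly positive part plus a
  nonnegative one.\<close>

lemma pos_upto_path_poly_plus_diff:
  assumes "q \<ge> 2"
  shows "pos_upto (length w) (path_poly q w + [:0, 1:] * path_diff q w)"
proof (cases "w = []")
  case True
  then show ?thesis by (auto simp: end_diff_def pos_upto_def one_pCons coeff_pCons split: nat.splits)
next
  case False
  have "coeff (path_poly q (butlast w)) k \<ge> 0" for k
    using pos_upto_path_poly_aux[OF assms, of "butlast w"]
    by (cases "butlast w = []") (auto simp: pos_upto_def)
  then have nonneg: "coeff ([:0, 1:] * path_poly q (butlast w)) k \<ge> 0" for k
    by (simp add: coeff_pCons split: nat.split)
  have "path_poly q w + [:0, 1:] * path_diff q w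
    = (path_poly q w - [:0, 1:] * path_poly q (tl w)) + [:0, 1:] * path_poly q (butlast w)"
    by (simp add: end_diff_def map_tl map_butlast algebra_simps)
  then show ?thesis
    using pos_upto_add[OF conjunct2[OF pos_upto_path_poly_aux[OF assms False]] nonneg]
    by (simp only:)
qed

text \<open>Reversing the word fixes K and flips the sign of D.\<close>

lemma pos_upto_path_poly_minus_diff:
  assumes "q \<ge> 2"
  shows "pos_upto (length w) (path_poly q w - [:0, 1:] * path_diff q w)"
  using pos_upto_path_poly_plus_diff[OF assms, of "rev w"]
  by (simp add: rev_map[symmetric] end_diff_rev del: mult_pCons_left)

text \<open>The weights of the end letters differ by -x in the core of \<open>S\<close> and by x in
  \<open>Y\<close>. These opposite signs turn the minus of the reversal identity into a
  gain.\<close>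

lemma cycle_poly_exchange:
  fixes u P Q :: "nat list"
  assumes "q \<ge> 2" "rev u = u"
  defines "S \<equiv> u @ (0 # P @ [1]) @ u" and "Y \<equiv> 1 # Q @ [0]"
  shows "\<exists>p. pos_upto (length P + length Q) p
    \<and> cycle_poly q (rev S @ Y) = cycle_poly q (S @ Y) + [:0, 1:] ^ (2 * (length u + 2)) * p"
proof -
  let ?x = "[:0, 1:] :: int poly"
  let ?p = "(path_poly q P - ?x * path_diff q P) * (path_poly q Q + ?x * path_diff q Q)"
  \<comment> \<open>Bookkeeping of powers: D(S) carries the exponent
    \<open>2 * length u + 1\<close>, D(Y) carries 1, and the prefactor x^2 completes
    \<open>2 * (length u + 2)\<close>.\<close>
  have ring_S: "(x ^ 2) ^ n * (- x * a + x ^ 2 * d) = - (x ^ (2 * n + 1) * (a - x * d))"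
    for x a d :: "int poly" and n
  proof -
    have "y * (- x * a + x ^ 2 * d) = - (y * x * (a - x * d))" for y
      by (simp add: power2_eq_square algebra_simps)
    moreover have "x ^ (2 * n + 1) = (x ^ 2) ^ n * x"
      by (simp only: power_add power_mult power_one_right)
    ultimately show ?thesis by (simp only:)
  qed
  have ring_Y: "x * a + x ^ 2 * d = x * (a + x * d)" for x a d :: "int poly"
    by (simp add: power2_eq_square algebra_simps)
  have ring_SY: "c - x ^ 2 * - (x ^ (2 * n + 1) * a) * (x * d) = c + x ^ (2 * (n + 2)) * (a * d)"
    for x a c d :: "int poly" and n
  proof -
    have "x ^ (2 * (n + 2)) = x ^ 2 * x ^ (2 * n + 1) * x"
      by (simp add: power2_eq_square ac_simps)
    moreover have "c - x ^ 2 * - (y * a) * (x * d) = c + x ^ 2 * y * x * (a * d)" for y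
      by (simp add: ac_simps)
    ultimately show ?thesis by (simp only:)
  qed
  have w01: "letter_weight q 0 - letter_weight q 1 = - ?x"
    "letter_weight q 1 - letter_weight q 0 = ?x"
    by (simp_all add: letter_weight_def)
  have "path_diff q S = end_diff (?x ^ 2) (map (letter_weight q) u
      @ (letter_weight q 0 # map (letter_weight q) P @ [letter_weight q 1])
      @ rev (map (letter_weight q) u))"
    using assms(2) by (simp add: S_def rev_map)
  also have "\<dots> = (?x ^ 2) ^ length u * (- ?x * path_poly q P + ?x ^ 2 * path_diff q P)"
    by (simp only: end_diff_surround end_diff_Cons_snoc w01 length_map)
  also have "\<dots> = - (?x ^ (2 * length u + 1) * (path_poly q P - ?x * path_diff q P))"
    by (rule ring_S)
  finally have S: "path_diff q S
    = - (?x ^ (2 * length u + 1) * (path_poly q P - ?x * path_diff q P))" .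
  have "path_diff q Y = end_diff (?x ^ 2)
      (letter_weight q 1 # map (letter_weight q) Q @ [letter_weight q 0])"
    by (simp add: Y_def)
  also have "\<dots> = ?x * path_poly q Q + ?x ^ 2 * path_diff q Q"
    by (simp only: end_diff_Cons_snoc w01)
  also have "\<dots> = ?x * (path_poly q Q + ?x * path_diff q Q)"
    by (rule ring_Y)
  finally have Y: "path_diff q Y = ?x * (path_poly q Q + ?x * path_diff q Q)" .
  have "cycle_poly q (rev S @ Y) = cycle_poly q (S @ Y) - ?x ^ 2 * path_diff q S * path_diff q Y"
    using cyclic_continuant_reverse_segment
      [of "map (letter_weight q) S" "map (letter_weight q) Y" "?x ^ 2"]
    by (simp add: S_def Y_def rev_map)
  also have "\<dots> = cycle_poly q (S @ Y) + ?x ^ (2 * (length u + 2)) * ?p"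
    unfolding S Y by (rule ring_SY)
  finally have "cycle_poly q (rev S @ Y)
      = cycle_poly q (S @ Y) + ?x ^ (2 * (length u + 2)) * ?p" .
  moreover have "pos_upto (length P + length Q) ?p"
    using assms(1) by (intro pos_upto_mult pos_upto_path_poly_minus_diff pos_upto_path_poly_plus_diff)
  ultimately show ?thesis by blast
qed

section \<open>Independent sets of clique cycles\<close>

text \<open>An independent set of the clique cycle is encoded by the list of its choices in the
  successive cliques.\<close>

definition choices :: "nat \<Rightarrow> nat \<Rightarrow> nat option set" where
  "choices q c = insert None (Some ` {..<q + c})"

text \<open>\<open>Some 1\<close> is the vertex y of one clique and \<open>Some 0\<close> the vertex
  x of the next, so the excluded pair is a linking edge.\<close>

abbreviation unlinked :: "nat option \<Rightarrow> nat option \<Rightarrow> bool" where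
  "unlinked a b \<equiv> \<not> (a = Some 1 \<and> b = Some 0)"

definition path_choices :: "nat \<Rightarrow> nat list \<Rightarrow> nat option list set" where
  "path_choices q w = {f. list_all2 (\<lambda>a c. a \<in> choices q c) f w \<and> successively unlinked f}"

definition cycle_choices :: "nat \<Rightarrow> nat list \<Rightarrow> nat option list set" where
  "cycle_choices q w = {f \<in> path_choices q w. unlinked (last f) (hd f)}"

definition chosen :: "nat option list \<Rightarrow> nat" where
  "chosen f = length (filter (\<lambda>a. a \<noteq> None) f)"

section \<open>Generating polynomials of sets of choice lists\<close>

definition gen_poly :: "nat option list set \<Rightarrow> int poly" where
  "gen_poly A = (\<Sum>f\<in>A. [:0, 1:] ^ chosen f)"

lemma coeff_x_power: "coeff ([:0, 1:] ^ n :: int poly) k = (if k = n then 1 else 0)"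
  by (simp add: monom_altdef[of 1, simplified, symmetric])

lemma coeff_gen_poly:
  assumes "finite A"
  shows "coeff (gen_poly A) k = int (card {f \<in> A. chosen f = k})"
proof -
  have "coeff (gen_poly A) k = (\<Sum>f\<in>A. if k = chosen f then 1 else 0)"
    by (simp add: gen_poly_def coeff_sum coeff_x_power)
  also have "\<dots> = (\<Sum>f\<in>{f \<in> A. chosen f = k}. 1)"
    using assms by (intro sum.mono_neutral_cong_right) auto
  finally show ?thesis by simp
qed

lemma finite_path_choices: "finite (path_choices q w)"
proof (rule finite_subset)
  show "path_choices q w
    \<subseteq> {f. set f \<subseteq> (\<Union>c\<in>set w. choices q c) \<and> length f = length w}"
    by (fastforce simp: path_choices_def list_all2_conv_all_nth in_set_conv_nth)
  show "finite {f. set f \<subseteq> (\<Union>c\<in>set w. choices q c) \<and> length f = length w}"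
    by (intro finite_lists_length_eq) (auto simp: choices_def)
qed

lemma gen_poly_Un:
  "finite A \<Longrightarrow> finite B \<Longrightarrow> A \<inter> B = {} \<Longrightarrow> gen_poly (A \<union> B) = gen_poly A + gen_poly B"
  by (simp add: gen_poly_def sum.union_disjoint)

lemma gen_poly_image:
  assumes "inj h" "\<And>f. chosen (h f) = n + chosen f"
  shows "gen_poly (h ` A) = [:0, 1:] ^ n * gen_poly A"
proof -
  have "inj_on h A" using assms(1) by (rule inj_on_subset) simp
  then show ?thesis
    by (simp add: gen_poly_def sum.reindex assms(2) power_add sum_distrib_left
        del: mult_pCons_left mult_pCons_right)
qed

lemma sum_choices:
  "(\<Sum>a\<in>choices q c. [:0, 1:] ^ chosen [a]) = [:1, int (q + c):]"
  unfolding choices_def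
  by (subst sum.insert) (auto simp: chosen_def sum.reindex one_pCons of_nat_poly)

lemma path_choices_Nil: "path_choices q [] = {[]}"
  by (auto simp: path_choices_def)

lemma path_choices_single: "path_choices q [c] = (\<lambda>a. [a]) ` choices q c"
  by (auto simp: path_choices_def list_all2_Cons2)

text \<open>Prepending an arbitrary choice goes wrong only for lists beginning
  \<open>Some 1\<close>, \<open>Some 0\<close>. The rest of such a list is arbitrary, because a
  leading \<open>Some 0\<close> forbids nothing after it.\<close>

lemma gen_poly_path_choices_Cons_Cons:
  assumes "q \<ge> 2"
  shows "gen_poly (path_choices q (c # d # w))
    = [:1, int (q + c):] * gen_poly (path_choices q (d # w)) - [:0, 1:] ^ 2 * gen_poly (path_choices q w)"
proof -
  let ?bad = "(\<lambda>f. Some 1 # Some 0 # f) ` path_choices q w"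
  let ?all = "(\<lambda>(a, f). a # f) ` (choices q c \<times> path_choices q (d # w))"
  have "?all = path_choices q (c # d # w) \<union> ?bad"
    using assms
    by (auto simp: path_choices_def list_all2_Cons2 successively_Cons choices_def image_iff)
  moreover have "path_choices q (c # d # w) \<inter> ?bad = {}"
    by (auto simp: path_choices_def)
  ultimately have "gen_poly ?all = gen_poly (path_choices q (c # d # w)) + gen_poly ?bad"
    by (simp add: gen_poly_Un finite_path_choices)
  moreover have "gen_poly ?bad = [:0, 1:] ^ 2 * gen_poly (path_choices q w)"
    by (rule gen_poly_image) (auto simp: inj_def chosen_def)
  moreover have "gen_poly ?all = [:1, int (q + c):] * gen_poly (path_choices q (d # w))"
  proof -
    have "gen_poly ?all
        = (\<Sum>(a, f)\<in>choices q c \<times> path_choices q (d # w). [:0, 1:] ^ chosen (a # f))"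
      unfolding gen_poly_def by (subst sum.reindex) (auto simp: inj_on_def case_prod_unfold)
    also have "\<dots> = (\<Sum>(a, f)\<in>choices q c \<times> path_choices q (d # w).
        [:0, 1:] ^ chosen [a] * [:0, 1:] ^ chosen f)"
      by (intro sum.cong) (auto simp: chosen_def)
    also have "\<dots> = (\<Sum>a\<in>choices q c. [:0, 1:] ^ chosen [a]) * gen_poly (path_choices q (d # w))"
      by (simp add: gen_poly_def sum_product sum.cartesian_product)
    finally show ?thesis by (simp only: sum_choices)
  qed
  ultimately show ?thesis by simp
qed

text \<open>Lists violating only the closing link begin with \<open>Some 0\<close> and end with
  \<open>Some 1\<close>. A first \<open>Some 0\<close> does not restrict its successor, nor a last
  \<open>Some 1\<close> its predecessor, so the middle is an arbitrary path choice.\<close>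

lemma gen_poly_path_choices_ends:
  assumes "q \<ge> 2"
  shows "gen_poly (path_choices q (c # w @ [d]))
    = gen_poly (cycle_choices q (c # w @ [d])) + [:0, 1:] ^ 2 * gen_poly (path_choices q w)"
proof -
  let ?bad = "(\<lambda>f. Some 0 # f @ [Some 1]) ` path_choices q w"
  have form: "\<exists>a f b. g = a # f @ [b]" if "g \<in> path_choices q (c # w @ [d])" for g
    using that by (auto simp: path_choices_def list_all2_Cons2 list_all2_append2 length_Suc_conv)
  have ends: "Some 0 # f @ [Some 1] \<in> path_choices q (c # w @ [d]) \<longleftrightarrow> f \<in> path_choices q w" for f
  proof (cases "length f = length w")
    case True
    then have "hd (f @ [Some 1]) = (if f = [] then Some 1 else hd f)" by simp
    with True assms show ?thesis
      by (auto simp: path_choices_def list_all2_append successively_Cons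
          successively_append_iff choices_def)
  next
    case False
    then show ?thesis
      by (auto simp: path_choices_def dest!: list_all2_lengthD)
  qed
  have "path_choices q (c # w @ [d]) = cycle_choices q (c # w @ [d]) \<union> ?bad"
  proof (intro subset_antisym subsetI)
    fix g assume g: "g \<in> path_choices q (c # w @ [d])"
    then obtain a f b where "g = a # f @ [b]" using form by blast
    with g ends show "g \<in> cycle_choices q (c # w @ [d]) \<union> ?bad"
      by (cases "unlinked b a") (auto simp: cycle_choices_def)
  next
    fix g assume "g \<in> cycle_choices q (c # w @ [d]) \<union> ?bad"
    then show "g \<in> path_choices q (c # w @ [d])"
      using ends by (auto simp: cycle_choices_def)
  qed
  moreover have "cycle_choices q (c # w @ [d]) \<inter> ?bad = {}"
    by (auto simp: cycle_choices_def)
  moreover have "finite (cycle_choices q (c # w @ [d]))"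
    by (rule finite_subset[OF _ finite_path_choices]) (auto simp: cycle_choices_def)
  ultimately have "gen_poly (path_choices q (c # w @ [d]))
      = gen_poly (cycle_choices q (c # w @ [d])) + gen_poly ?bad"
    by (simp add: gen_poly_Un finite_path_choices)
  moreover have "gen_poly ?bad = [:0, 1:] ^ 2 * gen_poly (path_choices q w)"
    by (rule gen_poly_image) (auto simp: inj_def chosen_def)
  ultimately show ?thesis by simp
qed

lemma gen_poly_path_choices:
  assumes "q \<ge> 2"
  shows "gen_poly (path_choices q w) = path_poly q w"
proof (induction w rule: induct_list012)
  case 1
  show ?case by (simp add: path_choices_Nil gen_poly_def chosen_def)
next
  case (2 c)
  have "gen_poly (path_choices q [c]) = (\<Sum>a\<in>choices q c. [:0, 1:] ^ chosen [a])"
    by (simp add: path_choices_single gen_poly_def sum.reindex inj_on_def)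
  then show ?case
    by (simp add: sum_choices letter_weight_def)
next
  case (3 c d w)
  then show ?case
    by (simp add: gen_poly_path_choices_Cons_Cons[OF assms] letter_weight_def
        del: mult_pCons_left mult_pCons_right)
qed

lemma gen_poly_cycle_choices:
  assumes "q \<ge> 2" "length w \<ge> 2"
  shows "gen_poly (cycle_choices q w) = cycle_poly q w"
proof -
  obtain c v d where w: "w = c # v @ [d]"
  proof (cases w)
    case (Cons c w')
    with assms(2) have "w' \<noteq> []" by auto
    with Cons that show thesis by (cases w' rule: rev_cases) auto
  qed (use assms in simp)
  have "gen_poly (path_choices q w)
      = gen_poly (cycle_choices q w) + [:0, 1:] ^ 2 * gen_poly (path_choices q v)"
    unfolding w by (rule gen_poly_path_choices_ends[OF assms(1)])
  then have "gen_poly (cycle_choices q w) = path_poly q w - [:0, 1:] ^ 2 * path_poly q v"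
    by (simp only: gen_poly_path_choices[OF assms(1)] add_diff_cancel_right')
  then show ?thesis
    by (simp only: cyclic_continuant_def w list.map list.sel map_append butlast_snoc)
qed

section \<open>From choice lists to independent sets\<close>

definition choice_set :: "nat option list \<Rightarrow> (nat \<times> nat) set" where
  "choice_set f = {(i, v). i < length f \<and> f ! i = Some v}"

lemma card_choice_set: "card (choice_set f) = chosen f"
proof -
  have "choice_set f = (\<lambda>i. (i, the (f ! i))) ` {i. i < length f \<and> f ! i \<noteq> None}"
    by (force simp: choice_set_def)
  then have "card (choice_set f) = card {i. i < length f \<and> f ! i \<noteq> None}"
    by (simp add: card_image inj_on_def)
  then show ?thesis
    by (simp add: chosen_def length_filter_conv_card)
qed

text \<open>Indices modulo the length merge the path conditions with the closing one, in the form in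
  which the linking edges are given.\<close>

lemma cycle_choices_iff:
  assumes "w \<noteq> []"
  shows "f \<in> cycle_choices q w \<longleftrightarrow> length f = length w
    \<and> (\<forall>i<length w. f ! i \<in> choices q (w ! i) \<and> unlinked (f ! i) (f ! ((i + 1) mod length w)))"
    (is "?l \<longleftrightarrow> ?r")
proof -
  have *: "(\<forall>i<n. R i ((i + 1) mod n)) \<longleftrightarrow> (\<forall>i. Suc i < n \<longrightarrow> R i (Suc i)) \<and> R (n - 1) 0"
    if "n > 0" for R and n :: nat
  proof (intro iffI conjI allI impI)
    fix i assume *: "(\<forall>i. Suc i < n \<longrightarrow> R i (Suc i)) \<and> R (n - 1) 0" "i < n"
    show "R i ((i + 1) mod n)"
    proof (cases "Suc i = n")
      case True
      with * show ?thesis by auto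
    next
      case False
      with * show ?thesis by simp
    qed
  next
    assume *: "\<forall>i<n. R i ((i + 1) mod n)"
    then have "R (n - 1) ((n - 1 + 1) mod n)"
      using that by (metis diff_less zero_less_one)
    with that show "R (n - 1) 0" by simp
  next
    fix i assume "\<forall>i<n. R i ((i + 1) mod n)" "Suc i < n"
    then show "R i (Suc i)"
      by (metis Suc_eq_plus1 Suc_lessD mod_less)
  qed
  have "?l \<longleftrightarrow> length f = length w \<and> (\<forall>i<length w. f ! i \<in> choices q (w ! i))
     \<and> (\<forall>i. Suc i < length w \<longrightarrow> unlinked (f ! i) (f ! Suc i)) \<and> unlinked (f ! (length w - 1)) (f ! 0)"
  proof (cases "length f = length w")
    case True
    then have "f \<noteq> []" using assms by auto
    with True have "last f = f ! (length w - 1)" "hd f = f ! 0"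
      by (simp_all add: last_conv_nth hd_conv_nth)
    with True show ?thesis
      by (auto simp: cycle_choices_def path_choices_def list_all2_conv_all_nth successively_conv_nth)
  qed (auto simp: cycle_choices_def path_choices_def list_all2_conv_all_nth)
  also have "\<dots> \<longleftrightarrow> ?r"
    using *[of "length w" "\<lambda>i j. unlinked (f ! i) (f ! j)"] assms by auto
  finally show ?thesis .
qed

lemma choice_set_inject:
  assumes "length f = length g" "choice_set f = choice_set g"
  shows "f = g"
proof (rule nth_equalityI)
  fix i assume "i < length f"
  then have "f ! i = Some v \<longleftrightarrow> g ! i = Some v" for v
    using assms by (auto simp: choice_set_def set_eq_iff)
  then show "f ! i = g ! i"
    by (metis not_None_eq)
qed (fact assms(1))

lemma independent_clique_cycle_iff:
  "independent (clique_cycle q w) S \<longleftrightarrow>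
    (\<forall>(i, v)\<in>S. i < length w \<and> v < q + w ! i)
    \<and> (\<forall>i u v. (i, u) \<in> S \<and> (i, v) \<in> S \<longrightarrow> u = v)
    \<and> (\<forall>i<length w. \<not> ((i, 1) \<in> S \<and> ((i + 1) mod length w, 0) \<in> S))"
  (is "?l \<longleftrightarrow> ?r")
proof
  assume l: ?l
  then have S: "i < length w \<and> v < q + w ! i" if "(i, v) \<in> S" for i v
    using that by (auto simp: independent_def clique_cycle_def clique_verts_def)
  have "u = v" if "(i, u) \<in> S" "(i, v) \<in> S" for i u v
  proof (rule ccontr)
    assume "u \<noteq> v"
    then have "{(i, u), (i, v)} \<in> edges (clique_cycle q w)"
      using S[OF that(1)] S[OF that(2)] by (fastforce simp: clique_cycle_def clique_verts_def)
    with l that show False by (auto simp: independent_def)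
  qed
  moreover have "\<not> ((i, 1) \<in> S \<and> ((i + 1) mod length w, 0) \<in> S)" if "i < length w" for i
  proof -
    have "{(i, 1), ((i + 1) mod length w, 0)} \<in> edges (clique_cycle q w)"
      using that unfolding clique_cycle_def snd_conv by blast
    with l show ?thesis by (auto simp: independent_def)
  qed
  ultimately show ?r using S by blast
next
  assume r: ?r
  show ?l unfolding independent_def
  proof (intro conjI ballI notI)
    show "S \<subseteq> verts (clique_cycle q w)"
      using r by (fastforce simp: clique_cycle_def clique_verts_def)
    fix e assume e: "e \<in> edges (clique_cycle q w)" "e \<subseteq> S"
    have "(\<exists>i u v. e = {(i, u), (i, v)} \<and> u \<noteq> v)
        \<or> (\<exists>i<length w. e = {(i, 1), ((i + 1) mod length w, 0)})"
      using e(1) unfolding clique_cycle_def clique_verts_def snd_conv by blast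
    then consider (clique) i u v where "e = {(i, u), (i, v)}" "u \<noteq> v"
      | (link) i where "i < length w" "e = {(i, 1), ((i + 1) mod length w, 0)}"
      by blast
    then show False
    proof cases
      case clique
      then have "(i, u) \<in> S" "(i, v) \<in> S" using e(2) by auto
      with clique(2) r[THEN conjunct2, THEN conjunct1] show False by blast
    next
      case link
      then have "(i, 1) \<in> S" "((i + 1) mod length w, 0) \<in> S" using e(2) by auto
      with link(1) r[THEN conjunct2, THEN conjunct2] show False by blast
    qed
  qed
qed

lemma bij_betw_choice_set:
  assumes "w \<noteq> []"
  shows "bij_betw choice_set (cycle_choices q w) {S. independent (clique_cycle q w) S}"
  unfolding bij_betw_def
proof (intro conjI subset_antisym subsetI)
  show "inj_on choice_set (cycle_choices q w)"
    using choice_set_inject by (fastforce simp: inj_on_def cycle_choices_iff[OF assms])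
next
  fix S assume "S \<in> choice_set ` cycle_choices q w"
  then obtain f where f: "f \<in> cycle_choices q w" "S = choice_set f" by auto
  then have len: "length f = length w"
    by (simp add: cycle_choices_iff[OF assms])
  have f_choices: "f ! i \<in> choices q (w ! i)" if "i < length w" for i
    using that f(1) by (simp add: cycle_choices_iff[OF assms])
  have "v < q + w ! i" if "f ! i = Some v" "i < length w" for i v
    using f_choices[OF that(2)] that(1) by (auto simp: choices_def)
  moreover have "unlinked (f ! i) (f ! ((i + 1) mod length w))" if "i < length w" for i
    using f(1) that unfolding cycle_choices_iff[OF assms] by blast
  ultimately show "S \<in> {S. independent (clique_cycle q w) S}"
    unfolding mem_Collect_eq independent_clique_cycle_iff
    using assms by (auto simp: f(2) choice_set_def len)
next
  fix S assume "S \<in> {S. independent (clique_cycle q w) S}"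
  then have S: "\<And>i v. (i, v) \<in> S \<Longrightarrow> i < length w \<and> v < q + w ! i"
    "\<And>i u v. (i, u) \<in> S \<Longrightarrow> (i, v) \<in> S \<Longrightarrow> u = v"
    "\<And>i. i < length w \<Longrightarrow> \<not> ((i, 1) \<in> S \<and> ((i + 1) mod length w, 0) \<in> S)"
    unfolding mem_Collect_eq independent_clique_cycle_iff by blast+
  \<comment> \<open>An independent set meets each clique at most once, so the description is unique
    whenever it is used.\<close>
  define g where "g i = (if \<exists>v. (i, v) \<in> S then Some (THE v. (i, v) \<in> S) else None)" for i
  have g: "g i = Some v \<longleftrightarrow> (i, v) \<in> S" for i v
  proof -
    have "(THE v. (i, v) \<in> S) = v'" if "(i, v') \<in> S" for v'
      using that S(2) by blast
    then show ?thesis by (auto simp: g_def)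
  qed
  define f where "f = map g [0..<length w]"
  have nth: "f ! i = g i" if "i < length w" for i
    using that by (simp add: f_def)
  have "(i + 1) mod length w < length w" for i
    using assms by simp
  then have "unlinked (f ! i) (f ! ((i + 1) mod length w))" if "i < length w" for i
    using S(3)[OF that] that by (simp only: nth g) simp
  moreover have "f ! i \<in> choices q (w ! i)" if "i < length w" for i
    using S(1) g that by (cases "g i") (auto simp: nth choices_def)
  ultimately have "f \<in> cycle_choices q w"
    by (simp add: cycle_choices_iff[OF assms] f_def)
  moreover have "choice_set f = S"
    using S(1) g by (auto simp: choice_set_def nth f_def)
  ultimately show "S \<in> choice_set ` cycle_choices q w" by blast
qed

lemma indep_count_clique_cycle:
  assumes "w \<noteq> []"
  shows "int (indep_count (clique_cycle q w) j) = coeff (gen_poly (cycle_choices q w)) j"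
proof -
  have "bij_betw choice_set {f \<in> cycle_choices q w. chosen f = j}
      {S. independent (clique_cycle q w) S \<and> card S = j}"
  proof -
    have inj: "inj_on choice_set (cycle_choices q w)"
      and img: "choice_set ` cycle_choices q w = {S. independent (clique_cycle q w) S}"
      using bij_betw_choice_set[OF assms, of q] by (auto simp: bij_betw_def)
    have "choice_set ` {f \<in> cycle_choices q w. chosen f = j}
        = {S \<in> choice_set ` cycle_choices q w. card S = j}"
      by (auto simp: card_choice_set)
    with inj show ?thesis
      unfolding bij_betw_def by (auto simp: img intro: inj_on_subset)
  qed
  then have "card {f \<in> cycle_choices q w. chosen f = j} = indep_count (clique_cycle q w) j"
    unfolding indep_count_def by (rule bij_betw_same_card)
  moreover have "finite (cycle_choices q w)"
    by (rule finite_subset[OF _ finite_path_choices]) (auto simp: cycle_choices_def)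
  ultimately show ?thesis by (simp add: coeff_gen_poly)
qed

lemma coeff_indep_poly:
  assumes "finite (verts G)"
  shows "coeff (indep_poly G) n = int (indep_count G n)"
proof -
  have "indep_count G n = 0" if "n > card (verts G)"
  proof -
    have "card S \<le> card (verts G)" if "independent G S" for S
      using that assms by (auto simp: independent_def intro: card_mono)
    then have "{S. independent G S \<and> card S = n} = {}"
      using that by fastforce
    then show ?thesis by (simp only: indep_count_def card.empty)
  qed
  then show ?thesis
    by (auto simp: indep_poly_def coeff_sum not_le)
qed

lemma coeff_cycle_poly:
  assumes "q \<ge> 2" "length w \<ge> 2"
  shows "coeff (cycle_poly q w) j = int (indep_count (clique_cycle q w) j)"
proof -
  have "w \<noteq> []" using assms(2) by auto
  from indep_count_clique_cycle[OF this, of q j] show ?thesis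
    by (simp only: gen_poly_cycle_choices[OF assms])
qed

lemma indep_poly_clique_cycle:
  assumes "q \<ge> 2" "length w \<ge> 2"
  shows "indep_poly (clique_cycle q w) = cycle_poly q w"
proof (rule poly_eqI)
  have "finite (verts (clique_cycle q w))"
    using simple_graph_clique_cycle[OF assms(1)] by (simp add: simple_graph_def)
  then show "coeff (indep_poly (clique_cycle q w)) n = coeff (cycle_poly q w) n" for n
    by (simp only: coeff_indep_poly coeff_cycle_poly[OF assms])
qed

section \<open>Cyclic words\<close>

abbreviation fones :: "nat list \<Rightarrow> nat \<Rightarrow> nat \<Rightarrow> nat" where
  "fones w i s \<equiv> ones (cyclic_factor w i s)"

lemma length_cyclic_factor [simp]: "length (cyclic_factor w i s) = s"
  by (simp add: cyclic_factor_def)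

lemma nth_cyclic_factor [simp]:
  "k < s \<Longrightarrow> cyclic_factor w i s ! k = w ! ((i + k) mod length w)"
  by (simp add: cyclic_factor_def)

lemma cyclic_factor_mod: "cyclic_factor w (i mod length w) s = cyclic_factor w i s"
  by (simp add: cyclic_factor_def mod_add_left_eq)

lemma cyclic_factor_add_length: "cyclic_factor w (length w + i) s = cyclic_factor w i s"
  by (simp add: cyclic_factor_def add.assoc)

lemma cyclic_factor_append:
  "cyclic_factor w i (s + t) = cyclic_factor w i s @ cyclic_factor w (i + s) t"
  by (rule nth_equalityI) (auto simp: nth_append add.assoc)

lemma fones_add: "fones w i (s + t) = fones w i s + fones w (i + s) t"
  by (simp add: cyclic_factor_append)

lemma cyclic_factor_0 [simp]: "cyclic_factor w i 0 = []"
  by (simp add: cyclic_factor_def)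

lemma cyclic_factor_0_length: "cyclic_factor w 0 (length w) = w"
  by (rule nth_equalityI) auto

lemma fones_length: "fones w i (length w) = ones w"
proof -
  \<comment> \<open>The window is split once at \<open>i\<close> and once at
    \<open>length w\<close>; by periodicity the two pieces of length \<open>i\<close> agree and
    cancel.\<close>
  have "fones w 0 (i + length w) = fones w 0 (length w + i)"
    by (simp add: add.commute)
  then show ?thesis
    unfolding fones_add using cyclic_factor_add_length[of w 0 i]
    by (simp add: cyclic_factor_0_length)
qed

lemma fones_1:
  assumes "binary_word w" "w \<noteq> []"
  shows "fones w i 1 = w ! (i mod length w)"
proof -
  have "w ! (i mod length w) \<in> set w"
    using assms(2) by simp
  then have "w ! (i mod length w) \<in> {0, 1}"
    using assms(1) by (auto simp: binary_word_def)
  then show ?thesis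
    by (auto simp: cyclic_factor_def)
qed

lemma fones_1_le: "fones w i 1 \<le> 1"
  by (simp add: cyclic_factor_def)

lemma cyclic_factor_rotate:
  assumes "w \<noteq> []"
  shows "cyclic_factor (rotate k w) i s = cyclic_factor w (k + i) s"
  by (rule nth_equalityI) (use assms in \<open>auto simp: nth_rotate add.assoc mod_add_right_eq\<close>)

lemma binary_word_rotate [simp]: "binary_word (rotate k w) \<longleftrightarrow> binary_word w"
  by (simp add: binary_word_def)

lemma ones_rotate [simp]: "ones (rotate k w) = ones w"
proof (induction k)
  case (Suc k)
  then show ?case by (cases "rotate k w") auto
qed simp

text \<open>Length \<open>r\<close> itself is excluded, so the least imbalance length qualifies. The
  one-sided bound suffices because \<open>i\<close> and \<open>j\<close> can be swapped.\<close>

definition balanced_upto :: "nat list \<Rightarrow> nat \<Rightarrow> bool" where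
  "balanced_upto w r \<longleftrightarrow> (\<forall>s<r. \<forall>i j. fones w i s \<le> fones w j s + 1)"

lemma balanced_upto_rotate: "w \<noteq> [] \<Longrightarrow> balanced_upto w r \<Longrightarrow> balanced_upto (rotate k w) r"
  by (simp add: balanced_upto_def cyclic_factor_rotate)

lemma least_imbalance_witness:
  assumes "\<not> balanced w"
  obtains i j where "fones w i (least_imbalance w) \<ge> fones w j (least_imbalance w) + 2"
proof -
  have "\<exists>i j. \<bar>int (fones w i (least_imbalance w)) - int (fones w j (least_imbalance w))\<bar> \<ge> 2"
    unfolding least_imbalance_def
  proof (rule LeastI_ex)
    obtain s i j where "\<not> \<bar>int (fones w i s) - int (fones w j s)\<bar> \<le> 1"
      using assms unfolding balanced_def by blast
    then have "\<bar>int (fones w i s) - int (fones w j s)\<bar> \<ge> 2" by linarith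
    then show "\<exists>s i j. \<bar>int (fones w i s) - int (fones w j s)\<bar> \<ge> 2" by blast
  qed
  then obtain i j
    where "\<bar>int (fones w i (least_imbalance w)) - int (fones w j (least_imbalance w))\<bar> \<ge> 2"
    by blast
  then show thesis
    using that[of i j] that[of j i] by linarith
qed

lemma balanced_upto_least_imbalance: "balanced_upto w (least_imbalance w)"
  unfolding balanced_upto_def
proof (intro allI impI)
  fix s i j assume "s < least_imbalance w"
  then have "\<not> \<bar>int (fones w i s) - int (fones w j s)\<bar> \<ge> 2"
    unfolding least_imbalance_def by (blast dest: not_less_Least)
  then show "fones w i s \<le> fones w j s + 1" by linarith
qed

text \<open>Used to see that an exchange, which keeps the balance below \<open>r\<close>, cannot
  lower the least imbalance length.\<close>

lemma least_imbalance_ge: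
  assumes "\<not> balanced w" "balanced_upto w r"
  shows "r \<le> least_imbalance w"
proof (rule ccontr)
  assume "\<not> r \<le> least_imbalance w"
  then have le: "fones w i (least_imbalance w) \<le> fones w j (least_imbalance w) + 1" for i j
    using assms(2) by (simp add: balanced_upto_def)
  obtain i j where "fones w i (least_imbalance w) \<ge> fones w j (least_imbalance w) + 2"
    using least_imbalance_witness[OF assms(1)] by blast
  with le[of i j] show False by linarith
qed

text \<open>Two windows that overlap differ by the windows of length \<open>k < r\<close> at their far ends.\<close>

lemma fones_shift_le:
  assumes "balanced_upto w r" "k < r"
  shows "fones w i r \<le> fones w (i + k) r + 1" "fones w (i + k) r \<le> fones w i r + 1"
proof -
  have "fones w i r = fones w i k + fones w (i + k) (r - k)"
    using fones_add[of w i k "r - k"] assms(2) by simp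
  moreover have "fones w (i + k) r = fones w (i + k) (r - k) + fones w (i + r) k"
    using fones_add[of w "i + k" "r - k" k] assms(2) by simp
  moreover have "fones w i k \<le> fones w (i + r) k + 1" "fones w (i + r) k \<le> fones w i k + 1"
    using assms by (auto simp: balanced_upto_def)
  ultimately show "fones w i r \<le> fones w (i + k) r + 1" "fones w (i + k) r \<le> fones w i r + 1"
    by linarith+
qed

section \<open>Structure of two windows of least imbalance length\<close>

context
  fixes w :: "nat list" and r i j :: nat
  assumes bal: "balanced_upto w r" and imbalance: "fones w i r \<ge> fones w j r + 2"
begin

lemma imbalance_length_ge_2: "r \<ge> 2"
proof (rule ccontr)
  assume "\<not> r \<ge> 2"
  then have "r = 0 \<or> r = 1" by auto
  then show False
    using imbalance fones_1_le[of w i] by auto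
qed

text \<open>The excess of at least 2 is shared by a proper prefix and the complementary suffix. Both
  are shorter than \<open>r\<close> and can contribute at most 1, so each contributes exactly
  1.\<close>

lemma imbalance_prefix_suffix:
  assumes "0 < k" "k < r"
  shows "fones w i k = fones w j k + 1"
    and "fones w (i + (r - k)) k = fones w (j + (r - k)) k + 1"
proof -
  have *: "fones w i k = fones w j k + 1 \<and> fones w (i + k) (r - k) = fones w (j + k) (r - k) + 1"
    if "0 < k" "k < r" for k
  proof -
    have "fones w i r = fones w i k + fones w (i + k) (r - k)"
      "fones w j r = fones w j k + fones w (j + k) (r - k)"
      using fones_add[of w i k "r - k"] fones_add[of w j k "r - k"] that by simp_all
    moreover have "fones w i k \<le> fones w j k + 1"
      "fones w (i + k) (r - k) \<le> fones w (j + k) (r - k) + 1"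
      using bal that by (auto simp: balanced_upto_def)
    ultimately show ?thesis using imbalance by linarith
  qed
  show "fones w i k = fones w j k + 1" using *[of k] assms by blast
  show "fones w (i + (r - k)) k = fones w (j + (r - k)) k + 1"
    using *[of "r - k"] assms by simp
qed

text \<open>A prefix of the heavy window exceeds the opposite suffix of the light one by at most 1,
  which is exactly what the heavy suffix does. The same argument with prefix and suffix exchanged
  gives equality.\<close>

lemma imbalance_palindrome:
  assumes "k \<le> r"
  shows "fones w i k = fones w (i + (r - k)) k"
proof -
  consider "k = 0" | "k = r" | "0 < k" "k < r" using assms by linarith
  then show ?thesis
  proof cases
    case 3
    have "fones w i k \<le> fones w (j + (r - k)) k + 1" "fones w (i + (r - k)) k \<le> fones w j k + 1"
      using bal 3 by (auto simp: balanced_upto_def)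
    then show ?thesis
      using imbalance_prefix_suffix[OF 3] by simp
  qed auto
qed

text \<open>Differences of consecutive prefix counts are letters: the heavy window reads
  \<open>1 u 1\<close> and the light one \<open>0 u 0\<close>, with the same palindrome
  \<open>u\<close>.\<close>

lemma imbalance_letters:
  shows "fones w i 1 = 1" "fones w j 1 = 0"
    "fones w (i + (r - 1)) 1 = 1" "fones w (j + (r - 1)) 1 = 0"
    "\<And>k. 0 < k \<Longrightarrow> k < r - 1 \<Longrightarrow> fones w (i + k) 1 = fones w (j + k) 1"
    "\<And>k. k < r \<Longrightarrow> fones w (i + k) 1 = fones w (i + (r - 1 - k)) 1"
proof -
  have r: "0 < (1::nat)" "1 < r" using imbalance_length_ge_2 by auto
  show "fones w i 1 = 1" "fones w j 1 = 0"
    "fones w (i + (r - 1)) 1 = 1" "fones w (j + (r - 1)) 1 = 0"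
    using imbalance_prefix_suffix[OF r] fones_1_le[of w i] fones_1_le[of w "i + (r - 1)"]
    by linarith+
  show "fones w (i + k) 1 = fones w (j + k) 1" if "0 < k" "k < r - 1" for k
    using imbalance_prefix_suffix(1)[of k] imbalance_prefix_suffix(1)[of "k + 1"] that
      fones_add[of w i k 1] fones_add[of w j k 1] by linarith
  show "fones w (i + k) 1 = fones w (i + (r - 1 - k)) 1" if "k < r" for k
  proof -
    have "i + (r - (k + 1)) + 1 = i + (r - k)" "r - (k + 1) = r - 1 - k"
      using that by auto
    then show ?thesis
      using imbalance_palindrome[of k] imbalance_palindrome[of "k + 1"] that
        fones_add[of w i k 1] fones_add[of w "i + (r - (k + 1))" 1 k]
      by (simp add: add.commute)
  qed
qed

end

text \<open>The light and heavy windows are disjoint, since overlapping ones differ by at most 1.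
  Starting at the light window, the word reads \<open>0 u 0 P 1 u 1 Q\<close>; moving its first
  letter to the end gives the claimed form.\<close>

lemma unbalanced_decomposition:
  assumes "binary_word w" "w \<noteq> []" "\<not> balanced w"
  obtains k u P Q where "rev u = u" "length u + 2 = least_imbalance w"
    "rotate k w = (u @ (0 # P @ [1]) @ u) @ (1 # Q @ [0])"
proof -
  define r where "r = least_imbalance w"
  obtain i j where ij: "fones w i r \<ge> fones w j r + 2"
    using least_imbalance_witness[OF assms(3)] unfolding r_def by blast
  note w = assms(2)
  define v where "v = rotate j w"
  define n where "n = length w"
  have n: "length v = n" "n > 0" using w by (auto simp: v_def n_def)
  \<comment> \<open>The start of the heavy window relative to the light one:
    \<open>n - j mod n\<close> represents -j modulo \<open>n\<close>.\<close>
  define k where "k = (i + (n - j mod n)) mod n"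
  have bal: "balanced_upto v r"
    unfolding v_def r_def by (intro balanced_upto_rotate w balanced_upto_least_imbalance)
  have k: "k < n" using n by (simp add: k_def)
  have "(j + k) mod n = i mod n"
  proof -
    have "(j + k) mod n = (j mod n + (i + (n - j mod n))) mod n"
      by (simp add: k_def mod_add_left_eq mod_add_right_eq)
    also have "j mod n + (i + (n - j mod n)) = i + n"
      using mod_less_divisor[OF n(2), of j] by linarith
    finally show ?thesis by simp
  qed
  then have "fones v k r = fones w i r"
    unfolding v_def cyclic_factor_rotate[OF w] by (metis cyclic_factor_mod n_def)
  moreover have "fones v 0 r = fones w j r"
    by (simp add: v_def cyclic_factor_rotate[OF w])
  ultimately have imb: "fones v k r \<ge> fones v 0 r + 2"
    using ij by simp
  have k_ge: "r \<le> k"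
    using fones_shift_le(2)[OF bal, of k 0] imb by (cases "k < r") auto
  \<comment> \<open>Otherwise the heavy window would overlap, across the end of the word, the next
    occurrence of the light window at position \<open>n\<close>.\<close>
  have k_le: "k + r \<le> n"
  proof (rule ccontr)
    assume "\<not> k + r \<le> n"
    then have "fones v k r \<le> fones v (k + (n - k)) r + 1"
      using k by (intro fones_shift_le(1)[OF bal]) linarith
    also have "fones v (k + (n - k)) r = fones v 0 r"
      using cyclic_factor_add_length[of v 0 r] k n by simp
    finally show False using imb by simp
  qed
  note lets = imbalance_letters[OF bal imb]
  have r2: "r \<ge> 2" by (rule imbalance_length_ge_2[OF bal imb])
  have v: "v \<noteq> []" "binary_word v" using n assms(1) by (auto simp: v_def)
  have letter: "fones v m 1 = v ! m" if "m < n" for m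
    using fones_1[OF v(2,1), of m] that n by simp
  define u where "u = map (\<lambda>m. v ! (1 + m)) [0..<r - 2]"
  define P where "P = take (k - r) (drop r v)"
  define Q where "Q = drop (k + r) v"
  have u: "length u = r - 2" "\<And>m. m < r - 2 \<Longrightarrow> u ! m = v ! Suc m"
    by (auto simp: u_def)
  have same: "v ! (k + m) = v ! m" if "0 < m" "m < r - 1" for m
    using lets(5)[OF that] letter[of m] letter[of "k + m"] that k_le by simp
  have ends: "v ! 0 = 0" "v ! (r - 1) = 0" "v ! k = 1" "v ! (k + (r - 1)) = 1"
    using lets(1-4) letter[of 0] letter[of k] letter[of "r - 1"] letter[of "k + (r - 1)"]
      k_le k r2 n by simp_all
  have "take r v = 0 # u @ [0]"
  proof (rule nth_equalityI)
    fix m assume "m < length (take r v)"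
    then have "m < r" by simp
    then consider "m = 0" | "m = r - 1" "m \<noteq> 0" | m' where "m = Suc m'" "m' < r - 2"
      by (cases m) (auto, linarith)
    then show "take r v ! m = (0 # u @ [0]) ! m"
      using ends r2 by cases (auto simp: u nth_append nth_Cons')
  qed (use k_le r2 n u in auto)
  moreover have "take r (drop k v) = 1 # u @ [1]"
  proof (rule nth_equalityI)
    fix m assume "m < length (take r (drop k v))"
    then have "m < r" by simp
    then consider "m = 0" | "m = r - 1" "m \<noteq> 0" | m' where "m = Suc m'" "m' < r - 2"
      by (cases m) (auto, linarith)
    then show "take r (drop k v) ! m = (1 # u @ [1]) ! m"
      using ends r2 k_le n same[of m] by cases (auto simp: u nth_append nth_Cons')
  qed (use k_le r2 n u in auto)
  moreover have "v = take r v @ P @ take r (drop k v) @ Q"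
  proof -
    have "drop r v = P @ drop k v"
      using append_take_drop_id[of "k - r" "drop r v"] k_ge by (simp add: P_def)
    moreover have "drop k v = take r (drop k v) @ Q"
      using append_take_drop_id[of r "drop k v"] by (simp add: Q_def add.commute)
    ultimately show ?thesis
      by (metis append_take_drop_id)
  qed
  ultimately have "v = (0 # u @ [0]) @ P @ (1 # u @ [1]) @ Q" by simp
  then have "rotate1 v = (u @ (0 # P @ [1]) @ u) @ (1 # Q @ [0])" by simp
  then have "rotate (Suc j) w = (u @ (0 # P @ [1]) @ u) @ (1 # Q @ [0])"
    by (simp add: v_def)
  moreover have "rev u = u"
  proof (rule nth_equalityI)
    fix m assume "m < length (rev u)"
    then have m: "m < r - 2" by (simp add: u)
    then have "rev u ! m = v ! Suc (r - 2 - Suc m)"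
      by (simp add: rev_nth u)
    also have "Suc (r - 2 - Suc m) = r - 1 - Suc m" using m by simp
    also have "v ! (r - 1 - Suc m) = v ! (k + (r - 1 - Suc m))"
      using same[of "r - 1 - Suc m"] m by simp
    also have "\<dots> = v ! (k + Suc m)"
      using lets(6)[of "Suc m"] letter[of "k + Suc m"] letter[of "k + (r - 1 - Suc m)"] m k_le by simp
    also have "\<dots> = u ! m"
      using same[of "Suc m"] m by (simp add: u)
    finally show "rev u ! m = u ! m" .
  qed simp
  moreover have "length u + 2 = least_imbalance w"
    using r2 u by (simp add: r_def)
  ultimately show thesis using that by blast
qed

text \<open>A short window crossing an end of the reversed segment only meets letters of \<open>u\<close> there.\<close>

lemma balanced_upto_reverse_segment:
  assumes "rev u = u" "Y \<noteq> []" and bal: "balanced_upto ((u @ M @ u) @ Y) (length u + 2)"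
  shows "balanced_upto (rev (u @ M @ u) @ Y) (length u + 2)"
proof -
  define S where "S = u @ M @ u"
  define n where "n = length (S @ Y)"
  have n: "n > length S" "n > 0" using assms(2) by (auto simp: n_def)
  have lenS: "length S = 2 * length u + length M" by (simp add: S_def)
  have revS: "rev S = u @ rev M @ u" using assms(1) by (simp add: S_def)
  have agree: "(rev S @ Y) ! m = (S @ Y) ! m"
    if "m < length u \<or> m \<ge> length S - length u" for m
    using that lenS by (auto simp: revS S_def nth_append assms(1))
  have "\<exists>i'. fones (rev S @ Y) i s = fones (S @ Y) i' s" if s: "s < length u + 2" and i: "i < n" for i s
  proof (cases "i + s \<le> length S")
    case True
    \<comment> \<open>A window inside the reversed segment is the mirror image of a window of
      \<open>S\<close>.\<close>
    have "cyclic_factor (rev S @ Y) i s = rev (cyclic_factor (S @ Y) (length S - i - s) s)"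
    proof (rule nth_equalityI)
      fix k assume "k < length (cyclic_factor (rev S @ Y) i s)"
      then have k: "k < s" by simp
      have "length S - Suc (i + k) = length S - i - s + (s - Suc k)"
        using k True by linarith
      moreover have "length S - Suc (i + k) < length S"
        using k True by linarith
      ultimately show "cyclic_factor (rev S @ Y) i s ! k
          = rev (cyclic_factor (S @ Y) (length S - i - s) s) ! k"
        using k True n by (simp add: rev_nth nth_append)
    qed simp
    then show ?thesis by (metis count_list_rev)
  next
    case False
    have "cyclic_factor (rev S @ Y) i s = cyclic_factor (S @ Y) i s"
    proof (rule nth_equalityI)
      fix k assume "k < length (cyclic_factor (rev S @ Y) i s)"
      then have k: "k < s" by simp
      \<comment> \<open>As \<open>s\<close> is at most \<open>length u + 1\<close> and the window
        leaves \<open>S\<close>, it starts no earlier than the final copy of \<open>u\<close>. If it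
        wraps around, it reaches only positions below \<open>length u\<close>.\<close>
      have "(i + k) mod n < length u \<or> (i + k) mod n \<ge> length S - length u"
      proof (cases "i + k < n")
        case True
        moreover have "length S - length u \<le> i + k" using False s by linarith
        ultimately show ?thesis by simp
      next
        case F: False
        then have "(i + k) mod n = (i + k - n) mod n"
          by (simp add: le_mod_geq)
        also have "\<dots> \<le> i + k - n" by simp
        finally show ?thesis using i k s F by linarith
      qed
      from agree[OF this] k show "cyclic_factor (rev S @ Y) i s ! k = cyclic_factor (S @ Y) i s ! k"
        by (simp add: n_def)
    qed simp
    then show ?thesis by auto
  qed
  then have ex: "\<exists>i'. fones (rev S @ Y) i s = fones (S @ Y) i' s" if "s < length u + 2" for i s
    using that cyclic_factor_mod[of "rev S @ Y" i s] n
    by (metis length_append length_rev mod_less_divisor n_def)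
  show ?thesis
    using bal ex unfolding balanced_upto_def S_def by metis
qed

section \<open>The balanced word\<close>

lemma div_add_bounds:
  fixes x y m :: nat
  shows "x div m + y div m \<le> (x + y) div m" "(x + y) div m \<le> x div m + y div m + 1"
proof -
  have "(x mod m + y mod m) div m \<le> 1" if "m > 0"
  proof -
    have "x mod m + y mod m < 2 * m"
      using mod_less_divisor[OF that, of x] mod_less_divisor[OF that, of y] by linarith
    then have "(x mod m + y mod m) div m < 2"
      using that by (simp only: div_less_iff_less_mult)
    then show ?thesis by simp
  qed
  then show "x div m + y div m \<le> (x + y) div m" "(x + y) div m \<le> x div m + y div m + 1"
    by (cases "m = 0"; simp add: div_add1_eq[of x y m])+
qed

context
  fixes \<alpha> \<rho> :: nat
  assumes \<rho>: "\<rho> < \<alpha>"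
begin

lemma length_balanced_word [simp]: "length (balanced_word \<alpha> \<rho>) = \<alpha>"
  by (simp add: balanced_word_def)

lemma balanced_word_le_1: "(i + 1) * \<rho> div \<alpha> \<le> i * \<rho> div \<alpha> + 1"
  using div_add_bounds(2)[of "i * \<rho>" \<rho> \<alpha>] \<rho> by (simp add: algebra_simps)

lemma binary_word_balanced_word: "binary_word (balanced_word \<alpha> \<rho>)"
proof -
  have "(i + 1) * \<rho> div \<alpha> - i * \<rho> div \<alpha> \<in> {0, 1}" for i
  proof -
    have "(i + 1) * \<rho> div \<alpha> - i * \<rho> div \<alpha> \<le> 1"
      using balanced_word_le_1[of i] by linarith
    then show ?thesis by (simp only: insert_iff) linarith
  qed
  then show ?thesis
    unfolding binary_word_def balanced_word_def set_map by (intro image_subsetI)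
qed

text \<open>The letters telescope. This persists past position \<alpha>, because advancing by
  \<alpha> raises the floor by exactly \<rho>.\<close>

lemma fones_balanced_word:
  "i * \<rho> div \<alpha> + fones (balanced_word \<alpha> \<rho>) i s = (i + s) * \<rho> div \<alpha>"
proof (induction s)
  case (Suc s)
  let ?m = "i + s"
  have ne: "balanced_word \<alpha> \<rho> \<noteq> []" using \<rho> by (simp add: balanced_word_def)
  have shift: "(?m mod \<alpha> + c) * \<rho> div \<alpha> + ?m div \<alpha> * \<rho> = (?m + c) * \<rho> div \<alpha>" for c
  proof -
    have "(?m + c) * \<rho> = (?m mod \<alpha> + c) * \<rho> + \<alpha> * (?m div \<alpha> * \<rho>)"
      by (metis (no_types, lifting) add.assoc add.commute distrib_right mod_mult_div_eq mult.assoc)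
    then show ?thesis using \<rho> by simp
  qed
  have "fones (balanced_word \<alpha> \<rho>) ?m 1 = (?m mod \<alpha> + 1) * \<rho> div \<alpha> - ?m mod \<alpha> * \<rho> div \<alpha>"
    unfolding fones_1[OF binary_word_balanced_word ne] using \<rho> by (simp add: balanced_word_def)
  moreover have "?m mod \<alpha> * \<rho> div \<alpha> \<le> (?m mod \<alpha> + 1) * \<rho> div \<alpha>"
    by (intro div_le_mono) simp
  ultimately have "?m * \<rho> div \<alpha> + fones (balanced_word \<alpha> \<rho>) ?m 1 = (?m + 1) * \<rho> div \<alpha>"
    using shift[of 0, unfolded add_0_right] shift[of 1] by linarith
  with Suc show ?case
    using fones_add[of "balanced_word \<alpha> \<rho>" i s 1] by simp
qed simp

lemma ones_balanced_word: "ones (balanced_word \<alpha> \<rho>) = \<rho>"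
  using fones_balanced_word[of 0 \<alpha>] fones_length[of "balanced_word \<alpha> \<rho>" 0] \<rho> by simp

text \<open>Every window of length \<open>s\<close> has \<open>s * \<rho> div \<alpha>\<close> ones
  or one more, wherever it starts.\<close>

lemma balanced_balanced_word: "balanced (balanced_word \<alpha> \<rho>)"
proof -
  have "s * \<rho> div \<alpha> \<le> fones (balanced_word \<alpha> \<rho>) i s"
    "fones (balanced_word \<alpha> \<rho>) i s \<le> s * \<rho> div \<alpha> + 1" for i s
    using fones_balanced_word[of i s] div_add_bounds[where x = "i * \<rho>" and y = "s * \<rho>" and m = \<alpha>]
    by (simp_all add: distrib_right)
  then show ?thesis
    unfolding balanced_def by (smt (verit) of_nat_1 of_nat_add of_nat_mono)
qed

end

section \<open>Uniqueness of the balanced word up to rotation\<close>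

lemma sum_fones: "(\<Sum>i<length w. fones w i s) = s * ones w"
proof (induction s)
  case (Suc s)
  have "fones w s t = (\<Sum>i<t. fones w (i + s) 1)" for t
    by (induction t) (use fones_add[of w s _ 1] in \<open>simp_all add: add.commute\<close>)
  then have "(\<Sum>i<length w. fones w (i + s) 1) = ones w"
    using fones_length[of w s] by metis
  moreover have "fones w i (Suc s) = fones w i s + fones w (i + s) 1" for i
    using fones_add[of w i s 1] by simp
  ultimately show ?case
    using Suc by (simp add: sum.distrib)
qed simp

text \<open>The deviations, scaled by the length, sum to zero over all starting positions, and any
  two differ by at most the length. One deviation of at least the length would give all of them the
  same weak sign and itself a strict one.\<close>

lemma balanced_close_to_mean:
  assumes "balanced w" "w \<noteq> []"
  shows "\<bar>int (length w) * int (fones w j s) - int s * int (ones w)\<bar> < int (length w)"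
proof (rule ccontr)
  let ?n = "length w"
  let ?d = "\<lambda>i. int ?n * int (fones w i s) - int s * int (ones w)"
  assume contr: "\<not> \<bar>?d j\<bar> < int ?n"
  have "(\<Sum>i<?n. ?d i) = int ?n * int (\<Sum>i<?n. fones w i s) - int ?n * (int s * int (ones w))"
    by (simp add: sum_subtractf sum_distrib_left)
  also have "\<dots> = 0" by (simp only: sum_fones of_nat_mult diff_self)
  finally have sum0: "(\<Sum>i<?n. ?d i) = 0" .
  have close: "?d i \<ge> ?d j - int ?n \<and> ?d i \<le> ?d j + int ?n" for i
  proof -
    have "\<bar>int (fones w i s) - int (fones w j s)\<bar> \<le> 1"
      using assms(1) by (simp add: balanced_def)
    then have "\<bar>int ?n * (int (fones w i s) - int (fones w j s))\<bar> \<le> int ?n"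
      by (simp add: abs_mult mult_left_le)
    then show ?thesis by (simp add: right_diff_distrib abs_le_iff)
  qed
  have n: "int ?n > 0" using assms(2) by simp
  let ?j = "j mod ?n"
  have j: "?j \<in> {..<?n}" "?d ?j = ?d j"
    using assms(2) by (auto simp: cyclic_factor_mod)
  from contr consider "?d j \<ge> int ?n" | "?d j \<le> - int ?n" by linarith
  then show False
  proof cases
    case 1
    then have "?d i \<ge> 0" for i using close[of i] by linarith
    moreover have "?d ?j > 0" using 1 j(2) n by linarith
    ultimately have "(\<Sum>i<?n. ?d i) > 0"
      using j(1) by (intro sum_pos2) auto
    with sum0 show False by linarith
  next
    case 2
    then have "- ?d i \<ge> 0" for i using close[of i] by linarith
    moreover have "- ?d ?j > 0" using 2 j(2) n by linarith
    ultimately have "(\<Sum>i<?n. - ?d i) > 0"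
      using j(1) by (intro sum_pos2) blast+
    then show False unfolding sum_negf using sum0 by linarith
  qed
qed

text \<open>The rotation starts where the prefix count exceeds its mean by the largest amount.\<close>

lemma balanced_imp_rotate_balanced_word:
  assumes "binary_word w" "balanced w" "\<rho> < length w" "ones w = \<rho>"
  shows "\<exists>k. w = rotate k (balanced_word (length w) \<rho>)"
proof -
  let ?n = "length w"
  \<comment> \<open>The scaled excess of a prefix over its mean. It is periodic, since a full period
    has excess zero.\<close>
  define d where "d i = int ?n * int (fones w 0 i) - int i * int \<rho>" for i
  have n: "?n > 0" "w \<noteq> []" using assms(3) by auto
  have d_add: "d (i + s) = d i + (int ?n * int (fones w i s) - int s * int \<rho>)" for i s
    using fones_add[of w 0 i s] by (simp add: d_def algebra_simps)
  have "d (i + ?n * t) = d i" for i t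
  proof (induction t)
    case (Suc t)
    have "d (i + ?n * Suc t) = d ((i + ?n * t) + ?n)" by (simp add: ac_simps)
    also have "\<dots> = d (i + ?n * t)"
      using d_add[of "i + ?n * t" ?n] fones_length[of w "i + ?n * t"] assms(4) by simp
    finally show ?case using Suc by simp
  qed simp
  then have d_mod: "d (i mod ?n) = d i" for i
    by (metis mod_mult_div_eq)
  obtain i where i: "i < ?n" and "\<forall>m<?n. d m \<le> d i"
  proof -
    have "Max (d ` {..<?n}) \<in> d ` {..<?n}"
      using n(1) by (intro Max_in) auto
    then obtain i where "i < ?n" "d i = Max (d ` {..<?n})" by auto
    then show thesis using that by simp
  qed
  then have d_max: "d m \<le> d i" for m
    using d_mod n(1) by (metis mod_less_divisor)
  \<comment> \<open>Maximality of \<open>d i\<close> bounds the count from above by the mean, and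
    balance keeps it within less than 1 of the mean; so it is the floor.\<close>
  have prefix: "fones w i s = s * \<rho> div ?n" for s
  proof -
    have "int ?n * int (fones w i s) \<le> int s * int \<rho>"
      using d_max[of "i + s"] d_add[of i s] by simp
    moreover have "int s * int \<rho> < int ?n * int (fones w i s) + int ?n"
      using balanced_close_to_mean[OF assms(2) n(2), of i s, unfolded assms(4) abs_less_iff]
      by linarith
    ultimately have "?n * fones w i s \<le> s * \<rho>" "s * \<rho> < ?n * Suc (fones w i s)"
      by (simp_all flip: of_nat_mult of_nat_add add: add.commute)
    then show ?thesis
      by (metis div_nat_eqI mult.commute)
  qed
  have "rotate i w = balanced_word ?n \<rho>"
  proof (rule nth_equalityI)
    fix m assume "m < length (rotate i w)"
    then have m: "m < ?n" by simp
    have "rotate i w ! m = fones w (i + m) 1"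
      using m n fones_1[OF assms(1) n(2), of "i + m"] by (simp add: nth_rotate)
    also have "\<dots> = fones w i (m + 1) - fones w i m"
      using fones_add[of w i m 1] by simp
    finally show "rotate i w ! m = balanced_word ?n \<rho> ! m"
      using m prefix[of m] prefix[of "m + 1"] by (simp add: balanced_word_def)
  qed (simp add: balanced_word_def)
  then have "rotate (?n - i) (balanced_word ?n \<rho>) = rotate ?n w"
    using i by (metis add.commute le_add_diff_inverse less_imp_le rotate_rotate)
  then show ?thesis by (metis rotate_length01 rotate_id mod_self)
qed

section \<open>Descent to the balanced word\<close>

lemma cycle_poly_rotate:
  assumes "length w \<ge> 2"
  shows "cycle_poly q (rotate k w) = cycle_poly q w"
  using cyclic_continuant_rotate[of "map (letter_weight q) w"] assms
  by (simp add: rotate_map[symmetric])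

text \<open>One exchange, performed on a rotation of \<open>w\<close>, which has the same cycle
  polynomial. The lengths of \<open>P\<close> and \<open>Q\<close> add up to
  \<open>length w - 2 * r\<close>.\<close>

lemma unbalanced_improvement:
  assumes "q \<ge> 2" "binary_word w" "w \<noteq> []" "\<not> balanced w"
  defines "r \<equiv> least_imbalance w"
  obtains w' p where "binary_word w'" "length w' = length w" "ones w' = ones w"
    "balanced_upto w' r" "2 * r \<le> length w" "pos_upto (length w - 2 * r) p"
    "cycle_poly q w' = cycle_poly q w + [:0, 1:] ^ (2 * r) * p"
proof -
  obtain k u P Q where u: "rev u = u" "length u + 2 = r"
    and rot: "rotate k w = (u @ (0 # P @ [1]) @ u) @ (1 # Q @ [0])" (is "_ = ?S @ ?Y")
    by (rule unbalanced_decomposition[OF assms(2,3,4), folded r_def])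
  let ?w' = "rev ?S @ ?Y"
  have "length (rotate k w) = 2 * r + (length P + length Q)"
    unfolding rot using u(2) by simp
  then have len: "length w = 2 * r + (length P + length Q)"
    by simp
  then have len2: "length w \<ge> 2" using u(2) by simp
  obtain p where p: "pos_upto (length P + length Q) p"
    "cycle_poly q ?w' = cycle_poly q (?S @ ?Y) + [:0, 1:] ^ (2 * (length u + 2)) * p"
    using cycle_poly_exchange[OF assms(1) u(1)] by blast
  show thesis
  proof (rule that)
    have "binary_word (rotate k w)" using assms(2) by simp
    then show "binary_word ?w'" unfolding rot binary_word_def by auto
    have "length ?w' = length (rotate k w)" unfolding rot by simp
    then show "length ?w' = length w" by simp
    have "ones ?w' = ones (rotate k w)" unfolding rot by simp
    then show "ones ?w' = ones w" by (simp only: ones_rotate)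
    have "balanced_upto (rotate k w) r"
      unfolding r_def by (intro balanced_upto_rotate balanced_upto_least_imbalance assms(3))
    then show "balanced_upto ?w' r"
      using balanced_upto_reverse_segment[OF u(1), of ?Y "0 # P @ [1]"] unfolding rot u(2) by blast
    show "2 * r \<le> length w" using len by simp
    show "pos_upto (length w - 2 * r) p" using p(1) len by simp
    show "cycle_poly q ?w' = cycle_poly q w + [:0, 1:] ^ (2 * r) * p"
      using p(2) cycle_poly_rotate[OF len2, of q k] unfolding rot u(2) by simp
  qed
qed

text \<open>Ensures that the range of strict coefficient inequalities is nonempty.\<close>

lemma least_imbalance_le_length:
  assumes "binary_word w" "w \<noteq> []" "\<not> balanced w"
  shows "2 * least_imbalance w \<le> length w"
  \<comment> \<open>The claim does not mention \<open>q\<close>, so the exchange is taken with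
    \<open>q = 2\<close>.\<close>
  using unbalanced_improvement[OF order.refl assms] by blast

lemma coeff_x_power_mult:
  "coeff ([:0, 1:] ^ n * p :: int poly) k = (if k < n then 0 else coeff p (k - n))"
  using coeff_monom_mult[of "1::int" n p k] by (simp add: monom_altdef)

lemma cycle_poly_balanced_word:
  assumes "q \<ge> 2" "length w \<ge> 2" "binary_word w" "balanced w" "ones w < length w"
  shows "cycle_poly q w = cycle_poly q (balanced_word (length w) (ones w))"
proof -
  obtain k where "w = rotate k (balanced_word (length w) (ones w))"
    using balanced_imp_rotate_balanced_word[OF assms(3,4,5) refl] by blast
  moreover have "length (balanced_word (length w) (ones w)) \<ge> 2"
    using assms(2) by (simp add: balanced_word_def)
  ultimately show ?thesis
    by (metis cycle_poly_rotate)
qed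

text \<open>Exchanges are iterated. Each strictly raises the coefficient of x^\<alpha>, so the
  number of words of length \<alpha> with a larger such coefficient drops.\<close>

lemma cycle_poly_unbalanced:
  assumes "q \<ge> 2" "\<alpha> \<ge> 2" "\<rho> < \<alpha>"
  shows "binary_word w \<Longrightarrow> length w = \<alpha> \<Longrightarrow> ones w = \<rho> \<Longrightarrow> \<not> balanced w \<Longrightarrow>
    \<exists>p. pos_upto (\<alpha> - 2 * least_imbalance w) p
      \<and> cycle_poly q (balanced_word \<alpha> \<rho>) = cycle_poly q w + [:0, 1:] ^ (2 * least_imbalance w) * p"
proof (induction "card {v. binary_word v \<and> length v = \<alpha>
    \<and> coeff (cycle_poly q v) \<alpha> > coeff (cycle_poly q w) \<alpha>}"
    arbitrary: w rule: less_induct)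
  case less
  let ?x = "[:0, 1:] :: int poly"
  define r where "r = least_imbalance w"
  have "w \<noteq> []" using less.prems assms(2) by auto
  from unbalanced_improvement[OF assms(1) less.prems(1) this less.prems(4), folded r_def]
  obtain w' p where w': "binary_word w'" "length w' = \<alpha>" "ones w' = \<rho>"
    "balanced_upto w' r" "2 * r \<le> \<alpha>" "pos_upto (\<alpha> - 2 * r) p"
    "cycle_poly q w' = cycle_poly q w + ?x ^ (2 * r) * p"
    using less.prems by metis
  show ?case
  proof (cases "balanced w'")
    case True
    then have "cycle_poly q w' = cycle_poly q (balanced_word \<alpha> \<rho>)"
      using cycle_poly_balanced_word[OF assms(1) _ w'(1)] w'(2,3) assms by simp
    then show ?thesis using w'(6,7) unfolding r_def by metis
  next
    case False
    define r' where "r' = least_imbalance w'"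
    have "coeff p (\<alpha> - 2 * r) > 0" using w'(6) by (simp add: pos_upto_def)
    then have gain: "coeff (cycle_poly q w) \<alpha> < coeff (cycle_poly q w') \<alpha>"
      unfolding w'(7) coeff_add coeff_x_power_mult using w'(5) by simp
    have "finite {v :: nat list. set v \<subseteq> {0, 1} \<and> length v = \<alpha>}"
      by (rule finite_lists_length_eq) simp
    then have "finite {v. binary_word v \<and> length v = \<alpha> \<and> P v}" for P
      by (rule rev_finite_subset) (auto simp: binary_word_def)
    then have "card {v. binary_word v \<and> length v = \<alpha> \<and> coeff (cycle_poly q v) \<alpha> > coeff (cycle_poly q w') \<alpha>}
        < card {v. binary_word v \<and> length v = \<alpha> \<and> coeff (cycle_poly q v) \<alpha> > coeff (cycle_poly q w) \<alpha>}"
      using gain w'(1,2) by (intro psubset_card_mono) auto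
    from less.hyps[OF this w'(1-3) False, folded r'_def]
    obtain p' where p': "pos_upto (\<alpha> - 2 * r') p'"
      "cycle_poly q (balanced_word \<alpha> \<rho>) = cycle_poly q w' + ?x ^ (2 * r') * p'"
      by blast
    \<comment> \<open>Hence the later gains are divisible by x^(2r) and add only nonnegative
      coefficients to the first gain \<open>p\<close>.\<close>
    have "r \<le> r'"
      unfolding r'_def by (rule least_imbalance_ge[OF False w'(4)])
    then have "2 * r' = 2 * r + 2 * (r' - r)" by simp
    then have "?x ^ (2 * r') = ?x ^ (2 * r) * ?x ^ (2 * (r' - r))"
      by (simp only: power_add[symmetric])
    then have "cycle_poly q (balanced_word \<alpha> \<rho>)
        = cycle_poly q w + ?x ^ (2 * r) * (p + ?x ^ (2 * (r' - r)) * p')"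
      unfolding p'(2) w'(7) by (simp only: distrib_left mult.assoc add.assoc)
    moreover have "pos_upto (\<alpha> - 2 * r) (p + ?x ^ (2 * (r' - r)) * p')"
      using p'(1) by (intro pos_upto_add w'(6)) (simp add: coeff_x_power_mult pos_upto_def)
    ultimately show ?thesis unfolding r_def by blast
  qed
qed

theorem theorem4p5:
  fixes \<alpha> q \<rho> :: nat and b :: "nat list"
  assumes "\<alpha> \<ge> 3" and "q \<ge> 2" and "\<rho> < \<alpha>"
  defines "b \<equiv> balanced_word \<alpha> \<rho>"
  shows "binary_word b \<and> length b = \<alpha> \<and> ones b = \<rho> \<and> balanced b
    \<and> (\<forall>b'. binary_word b' \<and> length b' = \<alpha> \<and> ones b' = \<rho> \<and> balanced b'
          \<longrightarrow> (\<exists>k. b' = rotate k b))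
    \<and> (\<forall>w. binary_word w \<and> length w = \<alpha> \<and> ones w = \<rho> \<longrightarrow>
          indep_poly (clique_cycle q w) \<preceq>\<^sub>c\<^sub>f indep_poly (clique_cycle q b)
        \<and> (indep_poly (clique_cycle q w) = indep_poly (clique_cycle q b) \<longleftrightarrow> balanced w)
        \<and> (\<not> balanced w \<longrightarrow>
            (\<forall>j. j < 2 * least_imbalance w \<longrightarrow>
               indep_count (clique_cycle q w) j = indep_count (clique_cycle q b) j)
          \<and> (\<forall>j. 2 * least_imbalance w \<le> j \<and> j \<le> \<alpha> \<longrightarrow>
               indep_count (clique_cycle q w) j < indep_count (clique_cycle q b) j)))"
proof -
  note b = length_balanced_word[OF assms(3)] ones_balanced_word[OF assms(3)]
    binary_word_balanced_word[OF assms(3)] balanced_balanced_word[OF assms(3)]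
  note b = b[folded b_def]
  have rot: "\<exists>k. b' = rotate k b"
    if "binary_word b'" "length b' = \<alpha>" "ones b' = \<rho>" "balanced b'" for b'
    using balanced_imp_rotate_balanced_word[of b' \<rho>] that assms(3) by (simp add: b_def)
  have main: "indep_poly (clique_cycle q w) \<preceq>\<^sub>c\<^sub>f indep_poly (clique_cycle q b)
        \<and> (indep_poly (clique_cycle q w) = indep_poly (clique_cycle q b) \<longleftrightarrow> balanced w)
        \<and> (\<not> balanced w \<longrightarrow>
            (\<forall>j. j < 2 * least_imbalance w \<longrightarrow>
               indep_count (clique_cycle q w) j = indep_count (clique_cycle q b) j)
          \<and> (\<forall>j. 2 * least_imbalance w \<le> j \<and> j \<le> \<alpha> \<longrightarrow>
               indep_count (clique_cycle q w) j < indep_count (clique_cycle q b) j))"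
    if w: "binary_word w" "length w = \<alpha>" "ones w = \<rho>" for w
  proof -
    let ?r = "least_imbalance w"
    have len2: "length w \<ge> 2" "length b \<ge> 2" "w \<noteq> []"
      using w(2) b(1) assms(1) by auto
    note polys = indep_poly_clique_cycle[OF assms(2) len2(1)] indep_poly_clique_cycle[OF assms(2) len2(2)]
    note counts = coeff_cycle_poly[OF assms(2) len2(1)] coeff_cycle_poly[OF assms(2) len2(2)]
    show ?thesis
    proof (cases "balanced w")
      case True
      then have "cycle_poly q w = cycle_poly q b"
        using cycle_poly_balanced_word[OF assms(2) len2(1) w(1)] w(2,3) assms(3) by (simp add: b_def)
      then show ?thesis using True by (simp only: polys cf_le_def) simp
    next
      case False
      obtain p where p: "pos_upto (\<alpha> - 2 * ?r) p"
        "cycle_poly q b = cycle_poly q w + [:0, 1:] ^ (2 * ?r) * p"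
        using cycle_poly_unbalanced[OF assms(2) _ assms(3) w False] assms(1) unfolding b_def by auto
      have low: "coeff (cycle_poly q w) j = coeff (cycle_poly q b) j" if "j < 2 * ?r" for j
        using that by (simp only: p(2) coeff_add coeff_x_power_mult) simp
      have high: "coeff (cycle_poly q w) j < coeff (cycle_poly q b) j" if "2 * ?r \<le> j" "j \<le> \<alpha>" for j
        using that p(1) unfolding p(2) coeff_add coeff_x_power_mult by (simp add: pos_upto_def)
      have le: "coeff (cycle_poly q w) j \<le> coeff (cycle_poly q b) j" for j
        using p(1) unfolding p(2) coeff_add coeff_x_power_mult by (simp add: pos_upto_def)
      \<comment> \<open>The strict inequality at degree \<open>2 * ?r\<close> therefore applies and
        separates the two polynomials.\<close>
      have "2 * ?r \<le> \<alpha>"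
        using least_imbalance_le_length[OF w(1) len2(3) False] w(2) by simp
      then have "cycle_poly q w \<noteq> cycle_poly q b"
        using high[of "2 * ?r"] by auto
      then show ?thesis
        using False le low high unfolding polys cf_le_def counts by simp
    qed
  qed
  show ?thesis using b rot main by blast
qed

end
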